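(* Let $(A,\cdot)$ be an anti-Leibniz algebra and $(M,\mathfrak{l},\mathfrak{r})$ a bimodule over $(A,\cdot)$. Let $P:M\to A$ be a linear map, identified with an element of $(A\ltimes M^{*})\otimes(A\ltimes M^{*})$ through $\mathrm{Hom}(M,A)\cong A\otimes M^{*}\subset(A\ltimes M^{*})\otimes(A\ltimes M^{*})$. Then $r:=P+\tau(P)$ is a symmetric solution of the anti-Leibniz Yang–Baxter equation in the semi-direct product anti-Leibniz algebra $A\ltimes M^{*}$ if and only if $P$ is a relative Rota–Baxter operator of $(A,\cdot)$ associated to $(M,\mathfrak{l},\mathfrak{r})$.
   Context: $\Bbbk$ is a field of characteristic zero; all vector spaces and algebras are finite-dimensional over $\Bbbk$. $\tau(a\otimes b)=b\otimes a$. An anti-Leibniz algebra $(A,\cdot)$ is a vector space with a bilinear product such that $a_1(a_2a_3)+(a_1a_2)a_3+a_2(a_1a_3)=0$. A bimodule over $(A,\cdot)$ is a vector space $M$ with linear maps $\mathfrak{l},\mathfrak{r}:A\to\mathfrak{gl}(M)$ satisfying, for all $a_1,a_2\in A$, $\mathfrak{l}(a_1a_2)+\mathfrak{l}(a_1)\mathfrak{l}(a_2)+\mathfrak{l}(a_2)\mathfrak{l}(a_1)=0$, $\mathfrak{l}(a_1)\mathfrak{r}(a_2)+\mathfrak{r}(a_2)\mathfrak{l}(a_1)+\mathfrak{r}(a_1a_2)=0$, $\mathfrak{r}(a_1a_2)+\mathfrak{r}(a_2)\mathfrak{r}(a_1)+\mathfrak{l}(a_1)\mathfrak{r}(a_2)=0$.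 For a bimodule $(M,\mathfrak{l},\mathfrak{r})$, the dual $(M^{*},\mathfrak{l}^{*},\mathfrak{l}^{*}-\mathfrak{r}^{*})$ is a bimodule, where $\langle\psi^{*}(a)(\xi),m\rangle=\langle\xi,\psi(a)(m)\rangle$ (no sign). The semi-direct product $A\ltimes M^{*}$ is $A\oplus M^{*}$ with product $(a_1,\xi_1)(a_2,\xi_2)=(a_1a_2,\ \mathfrak{l}^{*}(a_1)(\xi_2)+(\mathfrak{l}^{*}-\mathfrak{r}^{*})(a_2)(\xi_1))$; it is an anti-Leibniz algebra. If $\{e_i\}$ is a basis of $M$ with dual basis $\{f_i\}$, $P$ is identified with $\sum_i P(e_i)\otimes f_i$. For an anti-Leibniz algebra $B$ and $r=\sum_i x_i\otimes y_i\in B\otimes B$, the anti-Leibniz Yang–Baxter equation in $B$ is $\sum_{i,j}\big(x_ix_j\otimes y_i\otimes y_j+x_i\otimes y_ix_j\otimes y_j-x_j\otimes x_iy_j\otimes y_i-x_j\otimes x_i\otimes y_iy_j\big)=0$; $r$ is symmetric if $r=\tau(r)$. A relative Rota–Baxter operator of $(A,\cdot)$ associated to $(M,\mathfrak{l},\mathfrak{r})$ is a linear map $R:M\to A$ with $R(m_1)R(m_2)=R\big(\mathfrak{l}(R(m_1))(m_2)+\mathfrak{r}(R(m_2))(m_1)\big)$ for all $m_1,m_2\in M$. *)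

theory Defs
  imports Complex_Main "HOL-Library.Product_Plus" "HOL-Library.Function_Algebras" "HOL-Library.Poly_Mapping"
begin

section \<open>Anti-Leibniz algebras and bimodules\<close>

text \<open>The carrier \<open>V\<close> is a linear subspace of an ambient vector space. This is needed because a
  dual space is a proper subset of the type of all functions to the ground field.\<close>

locale anti_leibniz_algebra = vector_space scale
  for scale :: "'k::field_char_0 \<Rightarrow> 'b::ab_group_add \<Rightarrow> 'b" +
  fixes V :: "'b set" and mult :: "'b \<Rightarrow> 'b \<Rightarrow> 'b"
  assumes subspace_V: "subspace V"
    and finite_dim: "\<exists>S. finite S \<and> span S = V"
    and mult_closed: "\<And>x y. x \<in> V \<Longrightarrow> y \<in> V \<Longrightarrow> mult x y \<in> V"
    and mult_add_left: "\<And>x y z. x \<in> V \<Longrightarrow> y \<in> V \<Longrightarrow> z \<in> V \<Longrightarrow>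
          mult (x + y) z = mult x z + mult y z"
    and mult_add_right: "\<And>x y z. x \<in> V \<Longrightarrow> y \<in> V \<Longrightarrow> z \<in> V \<Longrightarrow>
          mult x (y + z) = mult x y + mult x z"
    and mult_scale_left: "\<And>c x y. x \<in> V \<Longrightarrow> y \<in> V \<Longrightarrow> mult (scale c x) y = scale c (mult x y)"
    and mult_scale_right: "\<And>c x y. x \<in> V \<Longrightarrow> y \<in> V \<Longrightarrow> mult x (scale c y) = scale c (mult x y)"
    and anti_leibniz: "\<And>x y z. x \<in> V \<Longrightarrow> y \<in> V \<Longrightarrow> z \<in> V \<Longrightarrow>
          mult x (mult y z) + mult (mult x y) z + mult y (mult x z) = 0"

locale anti_leibniz_bimodule =
  A: anti_leibniz_algebra scaleA UNIV mult + M: vector_space scaleM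
  for scaleA :: "'k::field_char_0 \<Rightarrow> 'a::ab_group_add \<Rightarrow> 'a"
    and mult :: "'a \<Rightarrow> 'a \<Rightarrow> 'a"
    and scaleM :: "'k \<Rightarrow> 'm::ab_group_add \<Rightarrow> 'm" +
  fixes l r :: "'a \<Rightarrow> 'm \<Rightarrow> 'm"
  assumes finite_dim_M: "\<exists>S. finite S \<and> M.span S = UNIV"
    and linear_l: "\<And>a. Vector_Spaces.linear scaleM scaleM (l a)"
    and linear_r: "\<And>a. Vector_Spaces.linear scaleM scaleM (r a)"
    and l_add: "\<And>a b m. l (a + b) m = l a m + l b m"
    and l_scale: "\<And>c a m. l (scaleA c a) m = scaleM c (l a m)"
    and r_add: "\<And>a b m. r (a + b) m = r a m + r b m"
    and r_scale: "\<And>c a m. r (scaleA c a) m = scaleM c (r a m)"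
    and bimodule1: "\<And>a b m. l (mult a b) m + l a (l b m) + l b (l a m) = 0"
    and bimodule2: "\<And>a b m. l a (r b m) + r b (l a m) + r (mult a b) m = 0"
    and bimodule3: "\<And>a b m. r (mult a b) m + r b (r a m) + l a (r b m) = 0"

definition relative_Rota_Baxter ::
  "('k::field \<Rightarrow> 'a::ab_group_add \<Rightarrow> 'a) \<Rightarrow> ('a \<Rightarrow> 'a \<Rightarrow> 'a) \<Rightarrow> ('k \<Rightarrow> 'm::ab_group_add \<Rightarrow> 'm) \<Rightarrow>
   ('a \<Rightarrow> 'm \<Rightarrow> 'm) \<Rightarrow> ('a \<Rightarrow> 'm \<Rightarrow> 'm) \<Rightarrow> ('m \<Rightarrow> 'a) \<Rightarrow> bool"
  where "relative_Rota_Baxter scaleA mult scaleM l r R \<longleftrightarrow>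
    Vector_Spaces.linear scaleM scaleA R \<and>
    (\<forall>m1 m2. mult (R m1) (R m2) = R (l (R m1) m2 + r (R m2) m1))"


section \<open>The semi-direct product with the dual bimodule\<close>

definition dual_space :: "('k::field \<Rightarrow> 'm::ab_group_add \<Rightarrow> 'm) \<Rightarrow> ('m \<Rightarrow> 'k) set"
  where "dual_space scaleM = {\<xi>. Vector_Spaces.linear scaleM (*) \<xi>}"

definition dual_action :: "('a \<Rightarrow> 'm \<Rightarrow> 'm) \<Rightarrow> 'a \<Rightarrow> ('m \<Rightarrow> 'k) \<Rightarrow> 'm \<Rightarrow> 'k"
  where "dual_action \<psi> a \<xi> = (\<lambda>m. \<xi> (\<psi> a m))"

definition semidirect_scale ::
  "('k::field \<Rightarrow> 'a::ab_group_add \<Rightarrow> 'a) \<Rightarrow> 'k \<Rightarrow> 'a \<times> ('m \<Rightarrow> 'k) \<Rightarrow> 'a \<times> ('m \<Rightarrow> 'k)"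
  where "semidirect_scale scaleA = (\<lambda>c (a, \<xi>). (scaleA c a, \<lambda>m. c * \<xi> m))"

definition semidirect_carrier ::
  "('k::field \<Rightarrow> 'm::ab_group_add \<Rightarrow> 'm) \<Rightarrow> ('a \<times> ('m \<Rightarrow> 'k)) set"
  where "semidirect_carrier scaleM = UNIV \<times> dual_space scaleM"

definition semidirect_mult ::
  "('a \<Rightarrow> 'a \<Rightarrow> 'a) \<Rightarrow> ('a \<Rightarrow> 'm \<Rightarrow> 'm) \<Rightarrow> ('a \<Rightarrow> 'm \<Rightarrow> 'm) \<Rightarrow>
   'a \<times> ('m \<Rightarrow> 'k::field) \<Rightarrow> 'a \<times> ('m \<Rightarrow> 'k) \<Rightarrow> 'a \<times> ('m \<Rightarrow> 'k)"
  where "semidirect_mult mult l r = (\<lambda>(a1, \<xi>1) (a2, \<xi>2).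
    (mult a1 a2, dual_action l a1 \<xi>2 + (dual_action l a2 \<xi>1 - dual_action r a2 \<xi>1)))"


section \<open>Tensor powers\<close>

text \<open>The tensor power \<open>V\<^sup>\<otimes>\<^sup>n\<close> is constructed as the free vector space on \<open>V\<^sup>n\<close> (finitely supported
  functions on lists of length \<open>n\<close>, where \<open>[x\<^sub>1, \<dots>, x\<^sub>n]\<close> stands for \<open>x\<^sub>1 \<otimes> \<dots> \<otimes> x\<^sub>n\<close>) modulo the
  multilinearity relations. Tensors are cosets, and maps on formal sums are transported to
  cosets by taking the union over all representatives, as in \<^theory>\<open>HOL.Equiv_Relations\<close>.\<close>

definition fs_scale :: "'k::field \<Rightarrow> ('p \<Rightarrow>\<^sub>0 'k) \<Rightarrow> ('p \<Rightarrow>\<^sub>0 'k)"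
  where "fs_scale c f = Poly_Mapping.map ((*) c) f"

definition lin_ext :: "('p \<Rightarrow> ('q \<Rightarrow>\<^sub>0 'k)) \<Rightarrow> ('p \<Rightarrow>\<^sub>0 'k::field) \<Rightarrow> ('q \<Rightarrow>\<^sub>0 'k)"
  where "lin_ext h f = (\<Sum>p\<in>Poly_Mapping.keys f. fs_scale (Poly_Mapping.lookup f p) (h p))"

definition pure :: "'b list \<Rightarrow> ('b list \<Rightarrow>\<^sub>0 'k::field)"
  where "pure xs = Poly_Mapping.single xs 1"

definition formal_tensors :: "nat \<Rightarrow> 'b set \<Rightarrow> ('b list \<Rightarrow>\<^sub>0 'k::field) set"
  where "formal_tensors n V = {f. Poly_Mapping.keys f \<subseteq> {xs. length xs = n \<and> set xs \<subseteq> V}}"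

definition tensor_relations ::
  "('k::field \<Rightarrow> 'b::ab_group_add \<Rightarrow> 'b) \<Rightarrow> nat \<Rightarrow> 'b set \<Rightarrow> ('b list \<Rightarrow>\<^sub>0 'k) set"
  where "tensor_relations scale n V = module.span fs_scale
    ({pure (xs[i := x + y]) - pure (xs[i := x]) - pure (xs[i := y]) | xs i x y.
        length xs = n \<and> set xs \<subseteq> V \<and> i < n \<and> x \<in> V \<and> y \<in> V} \<union>
     {pure (xs[i := scale c x]) - fs_scale c (pure (xs[i := x])) | xs i c x.
        length xs = n \<and> set xs \<subseteq> V \<and> i < n \<and> x \<in> V})"

definition tensor_cong ::
  "('k::field \<Rightarrow> 'b::ab_group_add \<Rightarrow> 'b) \<Rightarrow> nat \<Rightarrow> 'b set \<Rightarrow> (('b list \<Rightarrow>\<^sub>0 'k) \<times> ('b list \<Rightarrow>\<^sub>0 'k)) set"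
  where "tensor_cong scale n V = {(f, g). f \<in> formal_tensors n V \<and> g \<in> formal_tensors n V \<and>
    f - g \<in> tensor_relations scale n V}"

definition tensor_power ::
  "('k::field \<Rightarrow> 'b::ab_group_add \<Rightarrow> 'b) \<Rightarrow> nat \<Rightarrow> 'b set \<Rightarrow> ('b list \<Rightarrow>\<^sub>0 'k) set set"
  where "tensor_power scale n V = formal_tensors n V // tensor_cong scale n V"

definition tensor_class ::
  "('k::field \<Rightarrow> 'b::ab_group_add \<Rightarrow> 'b) \<Rightarrow> nat \<Rightarrow> 'b set \<Rightarrow> ('b list \<Rightarrow>\<^sub>0 'k) \<Rightarrow> ('b list \<Rightarrow>\<^sub>0 'k) set"
  where "tensor_class scale n V f = tensor_cong scale n V `` {f}"

definition tensor_add ::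
  "('k::field \<Rightarrow> 'b::ab_group_add \<Rightarrow> 'b) \<Rightarrow> nat \<Rightarrow> 'b set \<Rightarrow>
   ('b list \<Rightarrow>\<^sub>0 'k) set \<Rightarrow> ('b list \<Rightarrow>\<^sub>0 'k) set \<Rightarrow> ('b list \<Rightarrow>\<^sub>0 'k) set"
  where "tensor_add scale n V X Y = (\<Union>f\<in>X. \<Union>g\<in>Y. tensor_class scale n V (f + g))"

definition tensor_zero ::
  "('k::field \<Rightarrow> 'b::ab_group_add \<Rightarrow> 'b) \<Rightarrow> nat \<Rightarrow> 'b set \<Rightarrow> ('b list \<Rightarrow>\<^sub>0 'k) set"
  where "tensor_zero scale n V = tensor_class scale n V 0"

text \<open>On \<open>V \<otimes> V\<close>, reversing lists is the flip \<open>\<tau>(a \<otimes> b) = b \<otimes> a\<close>.\<close>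

definition formal_flip :: "('b list \<Rightarrow>\<^sub>0 'k::field) \<Rightarrow> ('b list \<Rightarrow>\<^sub>0 'k)"
  where "formal_flip = lin_ext (\<lambda>p. pure (rev p))"

definition tensor_flip ::
  "('k::field \<Rightarrow> 'b::ab_group_add \<Rightarrow> 'b) \<Rightarrow> 'b set \<Rightarrow> ('b list \<Rightarrow>\<^sub>0 'k) set \<Rightarrow> ('b list \<Rightarrow>\<^sub>0 'k) set"
  where "tensor_flip scale V X = (\<Union>f\<in>X. tensor_class scale 2 V (formal_flip f))"


section \<open>The anti-Leibniz Yang--Baxter equation\<close>

text \<open>The summand for \<open>p = x\<^sub>i \<otimes> y\<^sub>i\<close> and \<open>q = x\<^sub>j \<otimes> y\<^sub>j\<close>.\<close>

definition aybe_term :: "('b \<Rightarrow> 'b \<Rightarrow> 'b) \<Rightarrow> 'b list \<Rightarrow> 'b list \<Rightarrow> ('b list \<Rightarrow>\<^sub>0 'k::field)"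
  where "aybe_term mult p q =
    (let xi = p ! 0; yi = p ! 1; xj = q ! 0; yj = q ! 1 in
       pure [mult xi xj, yi, yj] + pure [xi, mult yi xj, yj]
       - pure [xj, mult xi yj, yi] - pure [xj, xi, mult yi yj])"

definition formal_aybe :: "('b \<Rightarrow> 'b \<Rightarrow> 'b) \<Rightarrow> ('b list \<Rightarrow>\<^sub>0 'k::field) \<Rightarrow> ('b list \<Rightarrow>\<^sub>0 'k)"
  where "formal_aybe mult f = lin_ext (\<lambda>p. lin_ext (\<lambda>q. aybe_term mult p q) f) f"

definition tensor_aybe ::
  "('k::field \<Rightarrow> 'b::ab_group_add \<Rightarrow> 'b) \<Rightarrow> 'b set \<Rightarrow> ('b \<Rightarrow> 'b \<Rightarrow> 'b) \<Rightarrow>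
   ('b list \<Rightarrow>\<^sub>0 'k) set \<Rightarrow> ('b list \<Rightarrow>\<^sub>0 'k) set"
  where "tensor_aybe scale V mult X = (\<Union>f\<in>X. tensor_class scale 3 V (formal_aybe mult f))"

definition symmetric_aybe_solution ::
  "('k::field \<Rightarrow> 'b::ab_group_add \<Rightarrow> 'b) \<Rightarrow> 'b set \<Rightarrow> ('b \<Rightarrow> 'b \<Rightarrow> 'b) \<Rightarrow> ('b list \<Rightarrow>\<^sub>0 'k) set \<Rightarrow> bool"
  where "symmetric_aybe_solution scale V mult X \<longleftrightarrow>
    X \<in> tensor_power scale 2 V \<and> X = tensor_flip scale V X \<and>
    tensor_aybe scale V mult X = tensor_zero scale 3 V"

text \<open>A linear map \<open>P : M \<rightarrow> A\<close> as the tensor \<open>\<Sum>\<^sub>e P(e) \<otimes> f\<^sub>e\<close>, where \<open>e\<close> runs over the basis \<open>E\<close> of \<open>M\<close>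
  and \<open>f\<^sub>e\<close> is the dual basis vector, i.e. the \<open>e\<close>-th coordinate function.\<close>

definition hom_tensor ::
  "('k::field \<Rightarrow> 'a::ab_group_add \<Rightarrow> 'a) \<Rightarrow> ('k \<Rightarrow> 'm::ab_group_add \<Rightarrow> 'm) \<Rightarrow> 'm set \<Rightarrow> ('m \<Rightarrow> 'a) \<Rightarrow>
   (('a \<times> ('m \<Rightarrow> 'k)) list \<Rightarrow>\<^sub>0 'k) set"
  where "hom_tensor scaleA scaleM E P =
    tensor_class (semidirect_scale scaleA) 2 (semidirect_carrier scaleM)
      (\<Sum>e\<in>E. pure [(P e, 0), (0, \<lambda>m. module.representation scaleM E m e)])"


section \<open>Well-definedness\<close>

lemma lookup_fs_scale [simp]: "Poly_Mapping.lookup (fs_scale c f) p = c * Poly_Mapping.lookup f p"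
  by (simp add: fs_scale_def Poly_Mapping.map.rep_eq when_def)

interpretation fs: vector_space "fs_scale :: 'k::field \<Rightarrow> ('p \<Rightarrow>\<^sub>0 'k) \<Rightarrow> _"
  by unfold_locales (auto intro!: poly_mapping_eqI simp: lookup_add algebra_simps)

lemma lin_ext_superset:
  assumes "finite K" "Poly_Mapping.keys f \<subseteq> K"
  shows "lin_ext h f = (\<Sum>p\<in>K. fs_scale (Poly_Mapping.lookup f p) (h p))"
  unfolding lin_ext_def using assms
  by (intro sum.mono_neutral_left) (auto simp: in_keys_iff)

lemma lin_ext_add: "lin_ext h (f + g) = lin_ext h f + lin_ext h g"
proof -
  let ?K = "Poly_Mapping.keys f \<union> Poly_Mapping.keys g"
  have "lin_ext h (f + g) = (\<Sum>p\<in>?K. fs_scale (Poly_Mapping.lookup (f + g) p) (h p))"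
    by (rule lin_ext_superset) (auto simp: Poly_Mapping.keys_add)
  moreover have "lin_ext h f = (\<Sum>p\<in>?K. fs_scale (Poly_Mapping.lookup f p) (h p))"
    "lin_ext h g = (\<Sum>p\<in>?K. fs_scale (Poly_Mapping.lookup g p) (h p))"
    by (rule lin_ext_superset; auto)+
  ultimately show ?thesis
    by (simp add: lookup_add fs.scale_left_distrib sum.distrib)
qed

lemma lin_ext_scale: "lin_ext h (fs_scale c f) = fs_scale c (lin_ext h f)"
proof -
  have "lin_ext h (fs_scale c f) =
      (\<Sum>p\<in>Poly_Mapping.keys f. fs_scale (Poly_Mapping.lookup (fs_scale c f) p) (h p))"
    by (rule lin_ext_superset) (auto simp: in_keys_iff)
  then show ?thesis
    by (simp add: lin_ext_def fs.scale_sum_right)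
qed

lemma lin_ext_diff: "lin_ext h (f - g) = lin_ext h f - lin_ext h g"
  using lin_ext_add[of h "f - g" g] by simp

lemma lin_ext_pure [simp]: "lin_ext h (pure p) = h p"
  by (simp add: lin_ext_def pure_def)

lemma lin_ext_in_subspace:
  assumes "fs.subspace N" "\<And>p. p \<in> Poly_Mapping.keys f \<Longrightarrow> h p \<in> N"
  shows "lin_ext h f \<in> N"
  unfolding lin_ext_def using assms by (intro fs.subspace_sum fs.subspace_scale) auto

lemma subspace_formal_tensors: "fs.subspace (formal_tensors n V)"
proof (rule fs.subspaceI)
  show "f + g \<in> formal_tensors n V" if "f \<in> formal_tensors n V" "g \<in> formal_tensors n V" for f g
    using that Poly_Mapping.keys_add[of f g] unfolding formal_tensors_def by blast
  show "fs_scale c f \<in> formal_tensors n V" if "f \<in> formal_tensors n V" for c f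
    using that unfolding formal_tensors_def by (auto simp: in_keys_iff)
qed (simp add: formal_tensors_def)

lemma pure_in_formal_tensors:
  "pure xs \<in> formal_tensors n V \<longleftrightarrow> length xs = n \<and> set xs \<subseteq> V"
  by (auto simp: formal_tensors_def pure_def)

lemma subspace_tensor_relations: "fs.subspace (tensor_relations scale n V)"
  by (simp add: tensor_relations_def)

lemma equiv_tensor_cong: "equiv (formal_tensors n V) (tensor_cong scale n V)"
proof (rule equivI)
  note N = subspace_tensor_relations[of scale n V]
  show "refl_on (formal_tensors n V) (tensor_cong scale n V)"
    using fs.subspace_0[OF N] by (auto simp: refl_on_def tensor_cong_def)
  show "tensor_cong scale n V \<subseteq> formal_tensors n V \<times> formal_tensors n V"
    by (auto simp: tensor_cong_def)
  show "sym (tensor_cong scale n V)"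
    using fs.subspace_neg[OF N] unfolding sym_def tensor_cong_def
    by (metis (mono_tags, lifting) case_prodD case_prodI mem_Collect_eq minus_diff_eq)
  show "trans (tensor_cong scale n V)"
  proof (rule transI)
    fix f g h assume "(f, g) \<in> tensor_cong scale n V" "(g, h) \<in> tensor_cong scale n V"
    then show "(f, h) \<in> tensor_cong scale n V"
      using fs.subspace_add[OF N, of "f - g" "g - h"] by (auto simp: tensor_cong_def)
  qed
qed

lemma tensor_cong_refl: "f \<in> formal_tensors n V \<Longrightarrow> (f, f) \<in> tensor_cong scale n V"
  by (simp add: tensor_cong_def fs.subspace_0[OF subspace_tensor_relations])

lemma tensor_class_eq_iff:
  assumes "f \<in> formal_tensors n V" "g \<in> formal_tensors n V"
  shows "tensor_class scale n V f = tensor_class scale n V g \<longleftrightarrow> f - g \<in> tensor_relations scale n V"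
  unfolding tensor_class_def using assms eq_equiv_class_iff[OF equiv_tensor_cong assms]
  by (auto simp: tensor_cong_def)

lemma UN_tensor_class:
  assumes "f \<in> formal_tensors n V" "F f \<in> formal_tensors m V"
    "\<And>g. (f, g) \<in> tensor_cong scale n V \<Longrightarrow> (F f, F g) \<in> tensor_cong scale m V"
  shows "(\<Union>g\<in>tensor_class scale n V f. tensor_class scale m V (F g)) = tensor_class scale m V (F f)"
proof -
  have "tensor_class scale m V (F g) = tensor_class scale m V (F f)"
    if "g \<in> tensor_class scale n V f" for g
    using that assms(3)[of g] equiv_class_eq[OF equiv_tensor_cong]
    by (fastforce simp: tensor_class_def)
  moreover have "f \<in> tensor_class scale n V f"
    using assms(1) by (simp add: tensor_class_def tensor_cong_refl)
  ultimately show ?thesis by blast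
qed

lemma tensor_add_class:
  assumes f: "f \<in> formal_tensors n V" and g: "g \<in> formal_tensors n V"
  shows "tensor_add scale n V (tensor_class scale n V f) (tensor_class scale n V g) =
    tensor_class scale n V (f + g)"
proof -
  note F = fs.subspace_add[OF subspace_formal_tensors[of n V]]
  note N = fs.subspace_add[OF subspace_tensor_relations[of scale n V]]
  have c: "tensor_class scale n V (f' + g') = tensor_class scale n V (f + g)"
    if "f' \<in> tensor_class scale n V f" "g' \<in> tensor_class scale n V g" for f' g'
  proof -
    have "f' \<in> formal_tensors n V" "g' \<in> formal_tensors n V"
      and *: "f - f' \<in> tensor_relations scale n V" "g - g' \<in> tensor_relations scale n V"
      using that by (auto simp: tensor_class_def tensor_cong_def)
    then have "tensor_class scale n V (f + g) = tensor_class scale n V (f' + g')"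
      using N[OF *] f g by (subst tensor_class_eq_iff) (auto intro!: F simp: algebra_simps)
    then show ?thesis ..
  qed
  have "f \<in> tensor_class scale n V f" "g \<in> tensor_class scale n V g"
    using f g by (simp_all add: tensor_class_def tensor_cong_refl)
  with c show ?thesis unfolding tensor_add_def by blast
qed

text \<open>A map on pure tensors that is multilinear modulo a subspace respects the relations.\<close>

lemma lin_ext_relations:
  assumes sub: "fs.subspace N"
    and add: "\<And>xs i x y. length xs = n \<Longrightarrow> set xs \<subseteq> V \<Longrightarrow> i < n \<Longrightarrow> x \<in> V \<Longrightarrow> y \<in> V \<Longrightarrow>
      h (xs[i := x + y]) - h (xs[i := x]) - h (xs[i := y]) \<in> N"
    and scale: "\<And>xs i c x. length xs = n \<Longrightarrow> set xs \<subseteq> V \<Longrightarrow> i < n \<Longrightarrow> x \<in> V \<Longrightarrow>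
      h (xs[i := scale c x]) - fs_scale c (h (xs[i := x])) \<in> N"
    and f: "f \<in> tensor_relations scale n V"
  shows "lin_ext h f \<in> N"
proof -
  let ?G = "{pure (xs[i := x + y]) - pure (xs[i := x]) - pure (xs[i := y]) | xs i x y.
        length xs = n \<and> set xs \<subseteq> V \<and> i < n \<and> x \<in> V \<and> y \<in> V} \<union>
     {pure (xs[i := scale c x]) - fs_scale c (pure (xs[i := x])) | xs i c x.
        length xs = n \<and> set xs \<subseteq> V \<and> i < n \<and> x \<in> V}"
  have "fs.subspace {f. lin_ext h f \<in> N}"
    using sub by (auto simp: fs.subspace_def lin_ext_add lin_ext_scale)
      (auto simp: lin_ext_def)
  moreover have "?G \<subseteq> {f. lin_ext h f \<in> N}"
    by (auto simp: lin_ext_diff lin_ext_scale intro!: add scale)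
  ultimately show ?thesis
    using f fs.span_minimal[of ?G "{f. lin_ext h f \<in> N}"] unfolding tensor_relations_def by blast
qed

lemma pure_add_relation:
  assumes "length xs = n" "set xs \<subseteq> V" "i < n" "x \<in> V" "y \<in> V"
  shows "pure (xs[i := x + y]) - pure (xs[i := x]) - pure (xs[i := y]) \<in> tensor_relations scale n V"
  unfolding tensor_relations_def by (rule fs.span_base) (use assms in blast)

lemma pure_scale_relation:
  assumes "length xs = n" "set xs \<subseteq> V" "i < n" "x \<in> V"
  shows "pure (xs[i := scale c x]) - fs_scale c (pure (xs[i := x])) \<in> tensor_relations scale n V"
  unfolding tensor_relations_def by (rule fs.span_base) (use assms in blast)

lemma pure3_relations:
  assumes "x \<in> V" "y \<in> V" "a \<in> V" "b \<in> V"
  shows "pure [x + y, a, b] - pure [x, a, b] - pure [y, a, b] \<in> tensor_relations scale 3 V"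
    "pure [a, x + y, b] - pure [a, x, b] - pure [a, y, b] \<in> tensor_relations scale 3 V"
    "pure [a, b, x + y] - pure [a, b, x] - pure [a, b, y] \<in> tensor_relations scale 3 V"
    "pure [scale c x, a, b] - fs_scale c (pure [x, a, b]) \<in> tensor_relations scale 3 V"
    "pure [a, scale c x, b] - fs_scale c (pure [a, x, b]) \<in> tensor_relations scale 3 V"
    "pure [a, b, scale c x] - fs_scale c (pure [a, b, x]) \<in> tensor_relations scale 3 V"
  using pure_add_relation[of "[x, a, b]" 3 V 0 x y scale] pure_add_relation[of "[a, x, b]" 3 V 1 x y scale]
    pure_add_relation[of "[a, b, x]" 3 V 2 x y scale] pure_scale_relation[of "[x, a, b]" 3 V 0 x scale c]
    pure_scale_relation[of "[a, x, b]" 3 V 1 x scale c] pure_scale_relation[of "[a, b, x]" 3 V 2 x scale c]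
    assms
  by simp_all

lemma formal_flip_in: "f \<in> formal_tensors n V \<Longrightarrow> formal_flip f \<in> formal_tensors n V"
  unfolding formal_flip_def
  by (rule lin_ext_in_subspace[OF subspace_formal_tensors])
    (auto simp: pure_def formal_tensors_def)

lemma formal_flip_relations:
  assumes "f \<in> tensor_relations scale n V"
  shows "formal_flip f \<in> tensor_relations scale n V"
  unfolding formal_flip_def
  by (rule lin_ext_relations[OF subspace_tensor_relations _ _ assms])
    (simp_all add: rev_update pure_add_relation pure_scale_relation)

lemma tensor_flip_class:
  assumes "f \<in> formal_tensors 2 V"
  shows "tensor_flip scale V (tensor_class scale 2 V f) = tensor_class scale 2 V (formal_flip f)"
  unfolding tensor_flip_def
proof (rule UN_tensor_class)
  show "(formal_flip f, formal_flip g) \<in> tensor_cong scale 2 V" if "(f, g) \<in> tensor_cong scale 2 V" for g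
    using that formal_flip_relations[of "f - g" scale 2 V]
    by (auto simp: tensor_cong_def formal_flip_in) (simp add: formal_flip_def lin_ext_diff)
qed (use assms formal_flip_in in auto)

context anti_leibniz_algebra
begin

lemma aybe_term_in:
  assumes "length p = 2" "set p \<subseteq> V" "length q = 2" "set q \<subseteq> V"
  shows "aybe_term mult p q \<in> formal_tensors 3 V"
proof -
  have "p ! 0 \<in> V" "p ! 1 \<in> V" "q ! 0 \<in> V" "q ! 1 \<in> V"
    using assms by (auto simp: subset_iff)
  then show ?thesis
    by (auto simp: aybe_term_def Let_def pure_in_formal_tensors mult_closed
        intro!: fs.subspace_add[OF subspace_formal_tensors] fs.subspace_diff[OF subspace_formal_tensors])
qed

lemma formal_aybe_in:
  assumes "f \<in> formal_tensors 2 V"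
  shows "formal_aybe mult f \<in> formal_tensors 3 V"
  unfolding formal_aybe_def using assms
  by (intro lin_ext_in_subspace[OF subspace_formal_tensors] aybe_term_in)
    (auto simp: formal_tensors_def)

lemma sum4_in_relations:
  assumes "a \<in> tensor_relations scale n V" "b \<in> tensor_relations scale n V"
    "c \<in> tensor_relations scale n V" "d \<in> tensor_relations scale n V"
    "e = a + b - c - d"
  shows "e \<in> tensor_relations scale n V"
  using assms subspace_tensor_relations[of scale n V]
  by (simp add: fs.subspace_add fs.subspace_diff)

lemma length2E:
  assumes "length p = 2" "set p \<subseteq> V"
  obtains x y where "p = [x, y]" "x \<in> V" "y \<in> V"
  using assms by (auto simp: length_Suc_conv numeral_2_eq_2)

lemma aybe_term_add:
  assumes "length p = 2" "set p \<subseteq> V" "length q = 2" "set q \<subseteq> V" "i < 2" "x \<in> V" "y \<in> V"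
  shows "aybe_term mult (p[i := x + y]) q - aybe_term mult (p[i := x]) q - aybe_term mult (p[i := y]) q
      \<in> tensor_relations scale 3 V" (is ?A)
    and "aybe_term mult q (p[i := x + y]) - aybe_term mult q (p[i := x]) - aybe_term mult q (p[i := y])
      \<in> tensor_relations scale 3 V" (is ?B)
proof -
  obtain a b where p: "p = [a, b]" "a \<in> V" "b \<in> V" by (rule length2E[OF assms(1,2)])
  obtain c d where q: "q = [c, d]" "c \<in> V" "d \<in> V" by (rule length2E[OF assms(3,4)])
  note rel = pure3_relations(1-3)
  from \<open>i < 2\<close> consider "i = 0" | "i = 1" by linarith
  then have "?A \<and> ?B"
  proof cases
    case 1
    have ?A
      by (rule sum4_in_relations[OF
            rel(1)[of "mult x c" _ "mult y c" b d] rel(1)[of x _ y "mult b c" d]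
            rel(2)[of "mult x d" _ "mult y d" c b] rel(2)[of x _ y c "mult b d"]])
        (use assms p q 1 in \<open>auto simp: aybe_term_def Let_def mult_closed mult_add_left mult_add_right\<close>)
    moreover have ?B
      by (rule sum4_in_relations[OF
            rel(1)[of "mult c x" _ "mult c y" d b] rel(2)[of "mult d x" _ "mult d y" c b]
            rel(1)[of x _ y "mult c b" d] rel(1)[of x _ y c "mult d b"]])
        (use assms p q 1 in \<open>auto simp: aybe_term_def Let_def mult_closed mult_add_left mult_add_right\<close>)
    ultimately show ?thesis ..
  next
    case 2
    have ?A
      by (rule sum4_in_relations[OF
            rel(2)[of x _ y "mult a c" d] rel(2)[of "mult x c" _ "mult y c" a d]
            rel(3)[of x _ y c "mult a d"] rel(3)[of "mult x d" _ "mult y d" c a]])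
        (use assms p q 2 in \<open>auto simp: aybe_term_def Let_def mult_closed mult_add_left mult_add_right\<close>)
    moreover have ?B
      by (rule sum4_in_relations[OF
            rel(3)[of x _ y "mult c a" d] rel(3)[of x _ y c "mult d a"]
            rel(2)[of "mult c x" _ "mult c y" a d] rel(3)[of "mult d x" _ "mult d y" a c]])
        (use assms p q 2 in \<open>auto simp: aybe_term_def Let_def mult_closed mult_add_left mult_add_right\<close>)
    ultimately show ?thesis ..
  qed
  then show ?A ?B by auto
qed

lemma aybe_term_scale:
  assumes "length p = 2" "set p \<subseteq> V" "length q = 2" "set q \<subseteq> V" "i < 2" "x \<in> V"
  shows "aybe_term mult (p[i := scale k x]) q - fs_scale k (aybe_term mult (p[i := x]) q)
      \<in> tensor_relations scale 3 V" (is ?A)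
    and "aybe_term mult q (p[i := scale k x]) - fs_scale k (aybe_term mult q (p[i := x]))
      \<in> tensor_relations scale 3 V" (is ?B)
proof -
  obtain a b where p: "p = [a, b]" "a \<in> V" "b \<in> V" by (rule length2E[OF assms(1,2)])
  obtain c d where q: "q = [c, d]" "c \<in> V" "d \<in> V" by (rule length2E[OF assms(3,4)])
  note rel = pure3_relations(4-6)[where c = k]
  note simps = aybe_term_def Let_def mult_closed mult_scale_left mult_scale_right
    fs.scale_right_distrib fs.scale_right_diff_distrib
  from \<open>i < 2\<close> consider "i = 0" | "i = 1" by linarith
  then have "?A \<and> ?B"
  proof cases
    case 1
    have ?A
      by (rule sum4_in_relations[OF
            rel(1)[of "mult x c" _ x b d] rel(1)[of x _ x "mult b c" d]
            rel(2)[of "mult x d" _ x c b] rel(2)[of x _ x c "mult b d"]])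
        (use assms p q 1 in \<open>auto simp: simps\<close>)
    moreover have ?B
      by (rule sum4_in_relations[OF
            rel(1)[of "mult c x" _ x d b] rel(2)[of "mult d x" _ x c b]
            rel(1)[of x _ x "mult c b" d] rel(1)[of x _ x c "mult d b"]])
        (use assms p q 1 in \<open>auto simp: simps\<close>)
    ultimately show ?thesis ..
  next
    case 2
    have ?A
      by (rule sum4_in_relations[OF
            rel(2)[of x _ x "mult a c" d] rel(2)[of "mult x c" _ x a d]
            rel(3)[of x _ x c "mult a d"] rel(3)[of "mult x d" _ x c a]])
        (use assms p q 2 in \<open>auto simp: simps\<close>)
    moreover have ?B
      by (rule sum4_in_relations[OF
            rel(3)[of x _ x "mult c a" d] rel(3)[of x _ x c "mult d a"]
            rel(2)[of "mult c x" _ x a d] rel(3)[of "mult d x" _ x a c]])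
        (use assms p q 2 in \<open>auto simp: simps\<close>)
    ultimately show ?thesis ..
  qed
  then show ?A ?B by auto
qed

lemma lin_ext_hom_add: "lin_ext (\<lambda>p. h p + h' p) f = lin_ext h f + lin_ext h' f"
  by (simp add: lin_ext_def fs.scale_right_distrib sum.distrib)

lemma lin_ext_hom_diff: "lin_ext (\<lambda>p. h p - h' p) f = lin_ext h f - lin_ext h' f"
  by (simp add: lin_ext_def fs.scale_right_diff_distrib sum_subtractf)

lemma lin_ext_hom_scale: "lin_ext (\<lambda>p. fs_scale c (h p)) f = fs_scale c (lin_ext h f)"
  by (simp add: lin_ext_def fs.scale_sum_right mult.commute)

lemma formal_aybe_cong:
  assumes "(f, g) \<in> tensor_cong scale 2 V"
  shows "(formal_aybe mult f, formal_aybe mult g) \<in> tensor_cong scale 3 V"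
proof -
  note N = subspace_tensor_relations[of scale 3 V]
  let ?T = "\<lambda>f g. lin_ext (\<lambda>p. lin_ext (\<lambda>q. aybe_term mult p q) g) f"
  from assms have f: "f \<in> formal_tensors 2 V" and g: "g \<in> formal_tensors 2 V"
    and d: "f - g \<in> tensor_relations scale 2 V"
    by (auto simp: tensor_cong_def)
  have keys: "length p = 2" "set p \<subseteq> V" if "p \<in> Poly_Mapping.keys f \<or> p \<in> Poly_Mapping.keys g" for p
    using that f g by (auto simp: formal_tensors_def)
  have "?T f (f - g) \<in> tensor_relations scale 3 V"
    by (intro lin_ext_in_subspace[OF N] lin_ext_relations[OF N _ _ d])
      (simp_all add: keys aybe_term_add aybe_term_scale)
  moreover have "?T (f - g) g \<in> tensor_relations scale 3 V"
    by (rule lin_ext_relations[OF N _ _ d];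
        unfold lin_ext_hom_diff[symmetric] lin_ext_hom_scale[symmetric];
        intro lin_ext_in_subspace[OF N])
      (simp_all add: keys aybe_term_add aybe_term_scale)
  moreover have "formal_aybe mult f - formal_aybe mult g = ?T f (f - g) + ?T (f - g) g"
    by (simp add: formal_aybe_def lin_ext_diff lin_ext_hom_diff)
  ultimately show ?thesis
    using f g fs.subspace_add[OF N] by (simp add: tensor_cong_def formal_aybe_in)
qed

lemma tensor_aybe_class:
  assumes "f \<in> formal_tensors 2 V"
  shows "tensor_aybe scale V mult (tensor_class scale 2 V f) = tensor_class scale 3 V (formal_aybe mult f)"
  unfolding tensor_aybe_def
  by (rule UN_tensor_class) (use assms formal_aybe_in formal_aybe_cong in auto)

text \<open>For \<open>r = \<Sum>\<^sub>i x\<^sub>i \<otimes> y\<^sub>i\<close> this is the usual formula.\<close>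

lemma tensor_aybe_sum:
  assumes "finite I" "\<And>i. i \<in> I \<Longrightarrow> x i \<in> V \<and> y i \<in> V"
  shows "tensor_aybe scale V mult (tensor_class scale 2 V (\<Sum>i\<in>I. pure [x i, y i])) =
    tensor_class scale 3 V (\<Sum>i\<in>I. \<Sum>j\<in>I.
      pure [mult (x i) (x j), y i, y j] + pure [x i, mult (y i) (x j), y j]
      - pure [x j, mult (x i) (y j), y i] - pure [x j, x i, mult (y i) (y j)])"
proof -
  have s: "lin_ext h (\<Sum>i\<in>I. pure [x i, y i]) = (\<Sum>i\<in>I. h [x i, y i])" for h :: "'b list \<Rightarrow> ('b list \<Rightarrow>\<^sub>0 'k)"
    using assms(1)
  proof induction
    case empty
    then show ?case by (simp add: lin_ext_def)
  qed (simp add: lin_ext_add)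
  have "(\<Sum>i\<in>I. pure [x i, y i] :: 'b list \<Rightarrow>\<^sub>0 'k) \<in> formal_tensors 2 V"
    using assms by (intro fs.subspace_sum[OF subspace_formal_tensors]) (auto simp: pure_in_formal_tensors)
  then show ?thesis
    by (simp only: tensor_aybe_class formal_aybe_def s) (simp add: aybe_term_def Let_def)
qed

end

section \<open>The semi-direct product is an anti-Leibniz algebra\<close>

lemma vector_space_semidirect:
  assumes "vector_space scaleA"
  shows "vector_space (semidirect_scale scaleA)"
proof -
  interpret vector_space scaleA by fact
  show ?thesis
    by unfold_locales
      (auto simp: semidirect_scale_def plus_prod_def fun_eq_iff algebra_simps scale_right_distrib scale_left_distrib)
qed

lemma in_dual_space_iff:
  assumes "vector_space scaleM"
  shows "\<xi> \<in> dual_space scaleM \<longleftrightarrow>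
    (\<forall>m n. \<xi> (m + n) = \<xi> m + \<xi> n) \<and> (\<forall>c m. \<xi> (scaleM c m) = c * \<xi> m)"
proof -
  interpret M: vector_space scaleM by fact
  interpret k: vector_space "(*) :: 'a \<Rightarrow> 'a \<Rightarrow> 'a"
    by unfold_locales (auto simp: algebra_simps)
  show ?thesis
    by (auto simp: dual_space_def Vector_Spaces.linear_iff M.vector_space_axioms k.vector_space_axioms)
qed

context anti_leibniz_bimodule
begin

lemma dual_iff: "\<xi> \<in> dual_space scaleM \<longleftrightarrow>
    (\<forall>m n. \<xi> (m + n) = \<xi> m + \<xi> n) \<and> (\<forall>c m. \<xi> (scaleM c m) = c * \<xi> m)"
  by (rule in_dual_space_iff) unfold_locales

lemma l_simps: "l a (m + n) = l a m + l a n" "l a (scaleM c m) = scaleM c (l a m)"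
  and r_simps: "r a (m + n) = r a m + r a n" "r a (scaleM c m) = scaleM c (r a m)"
  using linear_l[of a] linear_r[of a] by (simp_all add: Vector_Spaces.linear_iff)

lemma semidirect_finite_dim:
  "\<exists>S. finite S \<and> module.span (semidirect_scale scaleA) S = semidirect_carrier scaleM"
proof -
  interpret B: vector_space "semidirect_scale scaleA :: 'k \<Rightarrow> 'a \<times> ('m \<Rightarrow> 'k) \<Rightarrow> _"
    by (rule vector_space_semidirect) unfold_locales
  obtain SA where SA: "finite SA" "A.span SA = UNIV" using A.finite_dim by blast
  obtain S where S: "finite S" "M.span S = UNIV" using finite_dim_M by blast
  obtain E where E: "E \<subseteq> S" "M.independent E" "M.span E = UNIV"
    using M.maximal_independent_subset[of S] S by (metis M.span_span M.span_mono top.extremum_uniqueI)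
  have fE: "finite E" using E S finite_subset by blast
  let ?f = "\<lambda>e m. M.representation E m e"
  let ?D = "(\<lambda>a. (a, 0)) ` SA \<union> (\<lambda>e. (0, ?f e)) ` E"
  have sub: "B.subspace (semidirect_carrier scaleM)"
    by (rule B.subspaceI) (auto simp: semidirect_carrier_def semidirect_scale_def dual_iff
        zero_prod_def plus_prod_def algebra_simps)
  have "?f e \<in> dual_space scaleM" for e
    using E by (simp add: dual_iff M.representation_add M.representation_scale)
  then have "B.span ?D \<subseteq> semidirect_carrier scaleM"
    by (intro B.span_minimal sub) (auto simp: semidirect_carrier_def dual_iff)
  moreover have "(a, \<xi>) \<in> B.span ?D" if xi: "\<xi> \<in> dual_space scaleM" for a \<xi>
  proof -
    have "a \<in> A.span SA" using SA by simp
    then have 1: "(a, 0) \<in> B.span ?D"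
    proof (induction rule: A.span_induct_alt)
      case base
      then show ?case using B.span_zero[of ?D] by (simp only: zero_prod_def)
    next
      case (step c x y)
      have "semidirect_scale scaleA c (x, 0) + (y, 0) \<in> B.span ?D"
        by (rule B.span_add[OF B.span_scale[OF B.span_base] step(2)]) (use step(1) in blast)
      moreover have "semidirect_scale scaleA c (x, 0) + (y, 0 :: 'm \<Rightarrow> 'k) = (scaleA c x + y, 0)"
        by (simp add: semidirect_scale_def fun_eq_iff)
      ultimately show ?case by (simp only:)
    qed
    have 0: "\<xi> 0 = 0" using xi by (metis dual_iff add_cancel_right_left add.right_neutral)
    have xi_sum: "\<xi> (\<Sum>e\<in>F. scaleM (g e) e) = (\<Sum>e\<in>F. g e * \<xi> e)" if "finite F" for F g
      using that xi 0 by induction (auto simp: dual_iff)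
    have X: "\<xi> = (\<lambda>m. \<Sum>e\<in>E. \<xi> e * ?f e m)"
    proof
      fix m
      have "(\<Sum>e\<in>E. scaleM (?f e m) e) = m"
        using E fE by (intro M.sum_representation_eq) auto
      then show "\<xi> m = (\<Sum>e\<in>E. \<xi> e * ?f e m)"
        using xi_sum[OF fE, of "\<lambda>e. ?f e m"] by (simp add: mult.commute)
    qed
    have Y: "(\<Sum>e\<in>F. semidirect_scale scaleA (\<xi> e) (0, ?f e)) = (0, \<lambda>m. \<Sum>e\<in>F. \<xi> e * ?f e m)"
      if "finite F" for F
      using that by induction
        (auto simp: semidirect_scale_def zero_prod_def zero_fun_def plus_fun_def)
    have "(\<Sum>e\<in>E. semidirect_scale scaleA (\<xi> e) (0, ?f e)) \<in> B.span ?D"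
      by (intro B.span_sum B.span_scale B.span_base) blast
    then have "(0, \<xi>) \<in> B.span ?D"
      by (simp only: Y[OF fE] X[symmetric])
    from B.span_add[OF 1 this] show ?thesis by simp
  qed
  ultimately have "B.span ?D = semidirect_carrier scaleM"
    unfolding semidirect_carrier_def by fast
  moreover have "finite ?D" using SA(1) fE by simp
  ultimately show ?thesis by blast
qed

lemma semidirect_anti_leibniz:
  "anti_leibniz_algebra (semidirect_scale scaleA) (semidirect_carrier scaleM) (semidirect_mult mult l r)"
proof -
  interpret B: vector_space "semidirect_scale scaleA :: 'k \<Rightarrow> 'a \<times> ('m \<Rightarrow> 'k) \<Rightarrow> _"
    by (rule vector_space_semidirect) unfold_locales
  note defs = semidirect_carrier_def semidirect_scale_def semidirect_mult_def dual_action_def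
  note A_simps = A.mult_add_left A.mult_add_right A.mult_scale_left A.mult_scale_right
  show ?thesis
  proof unfold_locales
    show "\<exists>S. finite S \<and> B.span S = semidirect_carrier scaleM"
      by (rule semidirect_finite_dim)
    then show "B.subspace (semidirect_carrier scaleM)"
      by (metis B.subspace_span)
  next
    fix x y z :: "'a \<times> ('m \<Rightarrow> 'k)"
    assume "x \<in> semidirect_carrier scaleM" "y \<in> semidirect_carrier scaleM" "z \<in> semidirect_carrier scaleM"
    then obtain a \<xi> b \<eta> c \<zeta> where xyz: "x = (a, \<xi>)" "y = (b, \<eta>)" "z = (c, \<zeta>)"
      and d: "\<xi> \<in> dual_space scaleM" "\<eta> \<in> dual_space scaleM" "\<zeta> \<in> dual_space scaleM"
      by (auto simp: semidirect_carrier_def)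
    have add: "\<And>m n. \<xi> (m + n) = \<xi> m + \<xi> n" "\<And>m n. \<eta> (m + n) = \<eta> m + \<eta> n" "\<And>m n. \<zeta> (m + n) = \<zeta> m + \<zeta> n"
      using d by (auto simp: dual_iff)
    have zero: "\<xi> 0 = 0" "\<eta> 0 = 0" "\<zeta> 0 = 0"
      using add by (metis add_cancel_right_left add.right_neutral)+
    show "semidirect_mult mult l r (x + y) z = semidirect_mult mult l r x z + semidirect_mult mult l r y z"
      using d by (auto simp: xyz defs dual_iff A_simps l_add r_add fun_eq_iff)
    show "semidirect_mult mult l r x (y + z) = semidirect_mult mult l r x y + semidirect_mult mult l r x z"
      using d by (auto simp: xyz defs dual_iff A_simps l_add r_add fun_eq_iff)
    show "semidirect_mult mult l r x (semidirect_mult mult l r y z)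
        + semidirect_mult mult l r (semidirect_mult mult l r x y) z
        + semidirect_mult mult l r y (semidirect_mult mult l r x z) = 0"
    proof -
      have "\<zeta> (l b (l a m)) + \<zeta> (l (mult a b) m) + \<zeta> (l a (l b m)) = 0" for m
        using arg_cong[OF bimodule1[of a b m], of \<zeta>] by (simp add: add zero algebra_simps)
      moreover have "\<eta> (l c (l a m)) - \<eta> (r c (l a m)) + \<eta> (l a (l c m)) - \<eta> (l a (r c m))
          + \<eta> (l (mult a c) m) - \<eta> (r (mult a c) m) = 0" for m
        using arg_cong[OF bimodule1[of a c m], of \<eta>] arg_cong[OF bimodule2[of a c m], of \<eta>]
        unfolding add zero by algebra
      moreover have "\<xi> (l (mult b c) m) - \<xi> (r (mult b c) m) + \<xi> (l b (l c m)) - \<xi> (r b (l c m))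
          - \<xi> (l b (r c m)) + \<xi> (r b (r c m)) + \<xi> (l c (l b m)) - \<xi> (r c (l b m)) = 0" for m
        using arg_cong[OF bimodule1[of b c m], of \<xi>] arg_cong[OF bimodule2[of b c m], of \<xi>]
          arg_cong[OF bimodule2[of c b m], of \<xi>] arg_cong[OF bimodule3[of c b m], of \<xi>]
        unfolding add zero by algebra
      ultimately show ?thesis
        using A.anti_leibniz[of a b c]
        by (auto simp: xyz defs fun_eq_iff zero_prod_def algebra_simps)
    qed
  next
    fix x y :: "'a \<times> ('m \<Rightarrow> 'k)" and k :: 'k
    assume "x \<in> semidirect_carrier scaleM" "y \<in> semidirect_carrier scaleM"
    then show "semidirect_mult mult l r x y \<in> semidirect_carrier scaleM"
      "semidirect_mult mult l r (semidirect_scale scaleA k x) y = semidirect_scale scaleA k (semidirect_mult mult l r x y)"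
      "semidirect_mult mult l r x (semidirect_scale scaleA k y) = semidirect_scale scaleA k (semidirect_mult mult l r x y)"
      by (auto simp: defs dual_iff A_simps l_simps r_simps l_scale r_scale fun_eq_iff algebra_simps)
  qed
qed

end

end

theory Submission
  imports Defs
begin

text \<open>A formal tensor vanishes in \<open>V\<^sup>\<otimes>\<^sup>n\<close> iff every product \<open>\<phi>\<^sub>0 \<otimes> \<dots> \<otimes> \<phi>\<^sub>n\<^sub>-\<^sub>1\<close> of linear functionals
  kills it. Since \<open>M\<close> is finite-dimensional, a linear functional on \<open>A \<ltimes> M\<^sup>*\<close> has the form
  \<open>(a, \<xi>) \<mapsto> \<alpha>(a) + \<xi>(m)\<close>. Contracting the left-hand side of the Yang--Baxter equation at \<open>P + \<tau>(P)\<close>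
  with \<open>(\<alpha>\<^sub>0, m\<^sub>0)\<close>, \<open>(\<alpha>\<^sub>1, m\<^sub>1)\<close>, \<open>(\<alpha>\<^sub>2, m\<^sub>2)\<close> gives
  \<open>\<alpha>\<^sub>0(D(m\<^sub>1, m\<^sub>2)) + \<alpha>\<^sub>1(D(m\<^sub>0, m\<^sub>2) - D(m\<^sub>2, m\<^sub>0)) - \<alpha>\<^sub>2(D(m\<^sub>1, m\<^sub>0))\<close>, where
  \<open>D(m, n) = P(m) P(n) - P(l(P(m)) n + r(P(n)) m)\<close>.
  This vanishes for all choices iff \<open>D = 0\<close>.\<close>

section \<open>Contraction of formal tensors with products of functionals\<close>

definition tensor_eval :: "(nat \<Rightarrow> 'b \<Rightarrow> 'k::field) \<Rightarrow> ('b list \<Rightarrow>\<^sub>0 'k) \<Rightarrow> 'k"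
  where "tensor_eval \<phi> f =
    (\<Sum>p\<in>Poly_Mapping.keys f. Poly_Mapping.lookup f p * (\<Prod>i<length p. \<phi> i (p ! i)))"

text \<open>Finitely supported functions on the one-point type \<open>unit\<close> are a copy of the
  ground field. Through this copy the contraction is an instance of \<open>lin_ext\<close>: it
  inherits linearity, and \<open>lin_ext_relations\<close> becomes applicable.\<close>

lemma tensor_eval_lin_ext:
  "tensor_eval \<phi> f =
    Poly_Mapping.lookup (lin_ext (\<lambda>p. Poly_Mapping.single () (\<Prod>i<length p. \<phi> i (p ! i))) f) ()"
  by (simp add: tensor_eval_def lin_ext_def lookup_sum)

lemma tensor_eval_add: "tensor_eval \<phi> (f + g) = tensor_eval \<phi> f + tensor_eval \<phi> g"
  by (simp add: tensor_eval_lin_ext lin_ext_add lookup_add)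

lemma tensor_eval_diff: "tensor_eval \<phi> (f - g) = tensor_eval \<phi> f - tensor_eval \<phi> g"
  by (simp add: tensor_eval_lin_ext lin_ext_diff lookup_minus)

lemma tensor_eval_zero: "tensor_eval \<phi> 0 = 0"
  by (simp add: tensor_eval_def)

lemma tensor_eval_sum: "tensor_eval \<phi> (\<Sum>i\<in>I. f i) = (\<Sum>i\<in>I. tensor_eval \<phi> (f i))"
  by (induction I rule: infinite_finite_induct) (simp_all add: tensor_eval_zero tensor_eval_add)

lemma tensor_eval_pure: "tensor_eval \<phi> (pure p) = (\<Prod>i<length p. \<phi> i (p ! i))"
  by (simp add: tensor_eval_lin_ext)

text \<open>With the factor of slot \<open>i\<close> split off, the remaining product does not
  depend on \<open>x\<close>, so linearity in that slot can be read off.\<close>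

lemma tensor_eval_pure_update:
  assumes "i < length xs"
  shows "tensor_eval \<phi> (pure (xs[i := x])) =
    \<phi> i x * (\<Prod>j\<in>{..<length xs} - {i}. \<phi> j (xs ! j))"
proof -
  have "(\<Prod>j\<in>{..<length xs} - {i}. \<phi> j (xs[i := x] ! j)) = (\<Prod>j\<in>{..<length xs} - {i}. \<phi> j (xs ! j))"
    by (rule prod.cong) auto
  then show ?thesis
    using assms by (simp add: tensor_eval_pure prod.remove[of "{..<length xs}" i])
qed

section \<open>Separation of tensors by linear functionals\<close>

lemma formal_tensors_span:
  assumes f: "f \<in> formal_tensors n V"
  shows "f \<in> fs.span {pure xs | xs. length xs = n \<and> set xs \<subseteq> V}"
proof -
  have "f = (\<Sum>p\<in>Poly_Mapping.keys f. fs_scale (Poly_Mapping.lookup f p) (pure p))"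
    by (rule poly_mapping_eqI)
      (auto simp: lookup_sum pure_def lookup_single when_def in_keys_iff if_distrib sum.delta' cong: if_cong)
  also have "\<dots> \<in> fs.span {pure xs | xs. length xs = n \<and> set xs \<subseteq> V}"
    using f by (intro fs.span_sum fs.span_scale fs.span_base) (auto simp: formal_tensors_def)
  finally show ?thesis .
qed

lemma lin_ext_sum: "lin_ext h (\<Sum>i\<in>I. f i) = (\<Sum>i\<in>I. lin_ext h (f i))"
  by (induction I rule: infinite_finite_induct) (simp_all add: lin_ext_add, simp_all add: lin_ext_def)

text \<open>The entries of \<open>xs\<close> are replaced by elements of \<open>B\<close> one position \<open>k\<close> at a time.\<close>

lemma span_pure_lists:
  assumes "vector_space scale" "module.subspace scale V" "B \<subseteq> V" "V \<subseteq> module.span scale B"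
    and "length xs = n" "set xs \<subseteq> V"
  shows "pure xs \<in> fs.span (tensor_relations scale n V \<union> {pure bs | bs. length bs = n \<and> set bs \<subseteq> B})"
    (is "_ \<in> fs.span ?G")
proof -
  interpret vector_space scale by fact
  have rel: "f \<in> tensor_relations scale n V \<Longrightarrow> f \<in> fs.span ?G" for f
    by (auto intro: fs.span_base)
  \<comment> \<open>Entries from position \<open>k\<close> on already lie in \<open>B\<close>. For
    \<open>k = 0\<close> the whole word is in \<open>B\<close>; for \<open>k = n\<close> the
    condition is empty, which gives the claim.\<close>
  have "pure xs \<in> fs.span ?G"
    if "length xs = n" "set xs \<subseteq> V" "set (drop k xs) \<subseteq> B" "k \<le> n" for k xs
    using that
  proof (induction k arbitrary: xs)
    case 0
    then show ?case by (auto intro: fs.span_base)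
  next
    case (Suc k)
    have base: "pure (xs[k := b]) \<in> fs.span ?G" if "b \<in> B" for b
    proof (rule Suc.IH)
      show "set (xs[k := b]) \<subseteq> V"
        using Suc.prems that assms(3) by (meson set_update_subsetI subset_eq)
      have "drop k (xs[k := b]) = b # drop (Suc k) xs"
        using Suc.prems by (subst Cons_nth_drop_Suc[symmetric]) auto
      then show "set (drop k (xs[k := b])) \<subseteq> B" using Suc.prems that by simp
    qed (use Suc.prems in auto)
    have V: "xs ! k \<in> V" using Suc.prems by (meson Suc_le_lessD nth_mem subset_eq)
    have add: "pure (xs[k := x + y]) \<in> fs.span ?G"
      if "x \<in> V" "y \<in> V" "pure (xs[k := x]) \<in> fs.span ?G" "pure (xs[k := y]) \<in> fs.span ?G" for x y
    proof -
      have "pure (xs[k := x + y]) - pure (xs[k := x]) - pure (xs[k := y]) \<in> fs.span ?G"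
        using Suc.prems that by (intro rel pure_add_relation) auto
      from fs.span_add[OF fs.span_add[OF this that(3)] that(4)] show ?thesis by simp
    qed
    have scale: "pure (xs[k := scale c x]) \<in> fs.span ?G"
      if "x \<in> V" "pure (xs[k := x]) \<in> fs.span ?G" for c x
    proof -
      have "pure (xs[k := scale c x]) - fs_scale c (pure (xs[k := x])) \<in> fs.span ?G"
        using Suc.prems that by (intro rel pure_scale_relation) auto
      from fs.span_add[OF this fs.span_scale[OF that(2), of c]] show ?thesis by simp
    qed
    \<comment> \<open>The admissible entries at position \<open>k\<close> form a subspace containing
      \<open>B\<close>, hence exhaust \<open>V\<close>.\<close>
    have "subspace {x \<in> V. pure (xs[k := x]) \<in> fs.span ?G}"
    proof (rule subspaceI)
      \<comment> \<open>Homogeneity with the scalar \<open>0\<close> makes a word with an entry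
        \<open>0\<close> a relation.\<close>
      have "pure (xs[k := scale 0 0]) - fs_scale 0 (pure (xs[k := 0])) \<in> fs.span ?G"
        using Suc.prems subspace_0[OF assms(2)] by (intro rel pure_scale_relation) auto
      then show "0 \<in> {x \<in> V. pure (xs[k := x]) \<in> fs.span ?G}"
        using subspace_0[OF assms(2)] by simp
    qed (use add scale assms(2) in \<open>auto intro: subspace_add subspace_scale\<close>)
    then have "span B \<subseteq> {x \<in> V. pure (xs[k := x]) \<in> fs.span ?G}"
      using base assms(3) by (intro span_minimal) auto
    then show ?case using V assms(4) by (auto dest!: subsetD[of V _ "xs ! k"])
  qed
  from this[of xs n] show ?thesis using assms(5,6) by simp
qed

text \<open>A product of linear functionals is multilinear, so \<open>lin_ext_relations\<close>
  applies with the zero subspace as target.\<close>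

lemma tensor_eval_relation:
  assumes "\<And>i. Vector_Spaces.linear scale (*) (\<phi> i)" "f \<in> tensor_relations scale n V"
  shows "tensor_eval \<phi> f = 0"
proof -
  let ?h = "\<lambda>p. Poly_Mapping.single () (\<Prod>i<length p. \<phi> i (p ! i))"
  have lin: "\<phi> i (x + y) = \<phi> i x + \<phi> i y" "\<phi> i (scale c x) = c * \<phi> i x" for i c x y
    using assms(1)[of i] by (simp_all add: Vector_Spaces.linear_iff)
  have h: "?h p = Poly_Mapping.single () (tensor_eval \<phi> (pure p))" for p
    by (simp add: tensor_eval_pure)
  have "lin_ext ?h f \<in> {0}"
    by (rule lin_ext_relations[OF _ _ _ assms(2)])
      (simp_all add: h tensor_eval_pure_update lin poly_mapping_eq_iff fun_eq_iff lookup_add lookup_minus algebra_simps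
        del: length_list_update)
  then show ?thesis by (simp add: tensor_eval_lin_ext)
qed

text \<open>For the converse, \<open>f\<close> is reduced modulo relations to a combination
  \<open>h\<close> of words in a basis \<open>B\<close> of \<open>V\<close>. Products of coordinate
  functionals read off the coefficients of \<open>h\<close>, so all of these vanish.\<close>

lemma tensor_relations_iff_eval:
  assumes "vector_space scale" "module.subspace scale V" "f \<in> formal_tensors n V"
  shows "f \<in> tensor_relations scale n V \<longleftrightarrow>
    (\<forall>\<phi>. (\<forall>i. Vector_Spaces.linear scale (*) (\<phi> i)) \<longrightarrow> tensor_eval \<phi> f = 0)"
proof
  assume "f \<in> tensor_relations scale n V"
  then show "\<forall>\<phi>. (\<forall>i. Vector_Spaces.linear scale (*) (\<phi> i)) \<longrightarrow> tensor_eval \<phi> f = 0"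
    using tensor_eval_relation by blast
next
  assume 0: "\<forall>\<phi>. (\<forall>i. Vector_Spaces.linear scale (*) (\<phi> i)) \<longrightarrow> tensor_eval \<phi> f = 0"
  interpret vector_space scale by fact
  interpret k: vector_space "(*) :: 'a \<Rightarrow> 'a \<Rightarrow> 'a"
    by unfold_locales (auto simp: algebra_simps)
  let ?R = "tensor_relations scale n V"
  obtain B where B: "B \<subseteq> V" "independent B" "V \<subseteq> span B"
    using maximal_independent_subset[of V] by blast
  let ?L = "{pure bs | bs. length bs = n \<and> set bs \<subseteq> B}"
  \<comment> \<open>The functionals must be linear on the whole ambient space, not just on
    \<open>V\<close>, so coordinates are taken in a basis of that space extending
    \<open>B\<close>.\<close>
  let ?C = "extend_basis B"
  have C: "B \<subseteq> ?C" "independent ?C" "span ?C = UNIV"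
    using extend_basis_superset[OF B(2)] independent_extend_basis[OF B(2)] span_extend_basis[OF B(2)] by auto
  have "fs.span {pure xs | xs. length xs = n \<and> set xs \<subseteq> V} \<subseteq> fs.span (?R \<union> ?L)"
    using span_pure_lists[OF assms(1,2) B(1,3)] by (intro fs.span_minimal) auto
  then have "f \<in> fs.span (?R \<union> ?L)" using formal_tensors_span[OF assms(3)] by blast
  then obtain g h where gh: "f = g + h" "g \<in> fs.span ?R" "h \<in> fs.span ?L"
    by (auto simp: fs.span_Un)
  have g: "g \<in> ?R" using gh(2) by (simp add: tensor_relations_def fs.span_span)
  have "?L \<subseteq> formal_tensors n B"
    by (auto simp: pure_in_formal_tensors subset_iff)
  then have h: "h \<in> formal_tensors n B"
    using gh(3) fs.span_minimal[OF _ subspace_formal_tensors] by blast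
  have "Poly_Mapping.lookup h bs = 0" for bs
  proof (cases "bs \<in> Poly_Mapping.keys h")
    case True
    \<comment> \<open>On words \<open>p\<close> in \<open>B\<close> of length \<open>n\<close>, the
      product of these functionals is \<open>1\<close> at \<open>p = bs\<close> and \<open>0\<close>
      elsewhere.\<close>
    let ?\<phi> = "\<lambda>i x. if i < n then representation ?C x (bs ! i) else 0"
    have lin: "Vector_Spaces.linear scale (*) (?\<phi> i)" for i
      using C vector_space_axioms k.vector_space_axioms
      by (auto simp: Vector_Spaces.linear_iff representation_add representation_scale)
    have "(\<Prod>i<length p. ?\<phi> i (p ! i)) = (if p = bs then 1 else 0)" if "p \<in> Poly_Mapping.keys h" for p
    proof -
      have p: "length p = n" "set p \<subseteq> B" and bs: "length bs = n" "set bs \<subseteq> B"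
        using h that True by (auto simp: formal_tensors_def)
      have *: "?\<phi> i (p ! i) = (if p ! i = bs ! i then 1 else 0)" if "i < n" for i
        using that p C nth_mem[of i p] by (auto simp: representation_basis subset_iff)
      show ?thesis
      proof (cases "p = bs")
        case False
        then obtain i where "i < n" "p ! i \<noteq> bs ! i" using p bs nth_equalityI by metis
        then show ?thesis using False p * by (auto intro!: prod_zero)
      qed (use * bs in auto)
    qed
    then have "tensor_eval ?\<phi> h = (\<Sum>p\<in>Poly_Mapping.keys h. Poly_Mapping.lookup h p * (if p = bs then 1 else 0))"
      unfolding tensor_eval_def by (intro sum.cong) auto
    also have "\<dots> = Poly_Mapping.lookup h bs"
      using True by (simp add: if_distrib cong: if_cong)
    finally have "tensor_eval ?\<phi> h = Poly_Mapping.lookup h bs" .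
    moreover have "tensor_eval ?\<phi> g = 0" using tensor_eval_relation[OF lin g] .
    moreover have "tensor_eval ?\<phi> f = 0" by (rule 0[rule_format]) (rule lin)
    ultimately show ?thesis by (simp add: gh tensor_eval_add)
  qed (simp add: in_keys_iff)
  then have "h = 0" by (simp add: poly_mapping_eqI)
  with gh g show "f \<in> ?R" by simp
qed

section \<open>The tensor of a linear map in a finite basis of the bimodule\<close>

locale bimodule_with_linear_map =
  anti_leibniz_bimodule scaleA mult scaleM l r + E: finite_dimensional_vector_space scaleM E
  for scaleA :: "'k::field_char_0 \<Rightarrow> 'a::ab_group_add \<Rightarrow> 'a"
    and mult :: "'a \<Rightarrow> 'a \<Rightarrow> 'a"
    and scaleM :: "'k \<Rightarrow> 'm::ab_group_add \<Rightarrow> 'm"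
    and l r :: "'a \<Rightarrow> 'm \<Rightarrow> 'm"
    and E :: "'m set" +
  fixes P :: "'m \<Rightarrow> 'a"
  assumes linear_P: "Vector_Spaces.linear scaleM scaleA P"
begin

sublocale B: anti_leibniz_algebra "semidirect_scale scaleA" "semidirect_carrier scaleM"
  "semidirect_mult mult l r"
  by (rule semidirect_anti_leibniz)

abbreviation coord :: "'m \<Rightarrow> 'm \<Rightarrow> 'k"
  where "coord e m \<equiv> module.representation scaleM E m e"

definition defect :: "'m \<Rightarrow> 'm \<Rightarrow> 'a"
  where "defect m n = mult (P m) (P n) - P (l (P m) n + r (P n) m)"

text \<open>A representative of \<open>P + \<tau>(P)\<close> with the flip carried out termwise, so
  that symmetry and contraction can be computed on formal sums.\<close>

definition r_formal :: "('a \<times> ('m \<Rightarrow> 'k)) list \<Rightarrow>\<^sub>0 'k"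
  where "r_formal = (\<Sum>e\<in>E. pure [(P e, 0), (0, coord e)] + pure [(0, coord e), (P e, 0)])"

lemma P_simps: "P (m + n) = P m + P n" "P (scaleM c m) = scaleA c (P m)"
  using linear_P by (simp_all add: Vector_Spaces.linear_iff)

lemma coord_simps: "coord e (m + n) = coord e m + coord e n" "coord e (scaleM c m) = c * coord e m"
  using E.independent_Basis E.span_Basis
  by (simp_all add: M.representation_add M.representation_scale)

lemma coord_dual: "coord e \<in> dual_space scaleM"
  by (simp add: dual_iff coord_simps)

text \<open>Apply the functional \<open>g\<close> to the expansion of \<open>m\<close> in the basis
  \<open>E\<close>. This collapses the basis sums in the contraction and expands elements of the
  dual space in coordinate functionals.\<close>

lemma sum_coord:
  fixes g :: "'m \<Rightarrow> 'k"
  assumes "\<And>m n. g (m + n) = g m + g n" "\<And>c m. g (scaleM c m) = c * g m"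
  shows "(\<Sum>e\<in>E. g e * coord e m) = g m"
proof -
  have "g 0 = 0" using assms(1)[of 0 0] by simp
  then have "g (\<Sum>e\<in>F. scaleM (c e) e) = (\<Sum>e\<in>F. g e * c e)" for c F
    by (induction F rule: infinite_finite_induct) (simp_all add: assms mult.commute)
  moreover have "(\<Sum>e\<in>E. scaleM (coord e m) e) = m"
    using E.independent_Basis E.span_Basis E.finite_Basis by (intro M.sum_representation_eq) auto
  ultimately show ?thesis by metis
qed

lemma r_formal_in: "r_formal \<in> formal_tensors 2 (semidirect_carrier scaleM)"
  unfolding r_formal_def using coord_dual
  by (intro fs.subspace_sum[OF subspace_formal_tensors] fs.subspace_add[OF subspace_formal_tensors])
    (auto simp: pure_in_formal_tensors semidirect_carrier_def dual_iff)

lemma r_formal_class: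
  "tensor_add (semidirect_scale scaleA) 2 (semidirect_carrier scaleM)
      (hom_tensor scaleA scaleM E P)
      (tensor_flip (semidirect_scale scaleA) (semidirect_carrier scaleM) (hom_tensor scaleA scaleM E P)) =
    tensor_class (semidirect_scale scaleA) 2 (semidirect_carrier scaleM) r_formal"
proof -
  let ?p = "\<Sum>e\<in>E. pure [(P e, 0), (0, coord e)] :: ('a \<times> ('m \<Rightarrow> 'k)) list \<Rightarrow>\<^sub>0 'k"
  have p: "?p \<in> formal_tensors 2 (semidirect_carrier scaleM)"
    using coord_dual by (intro fs.subspace_sum[OF subspace_formal_tensors])
      (auto simp: pure_in_formal_tensors semidirect_carrier_def dual_iff)
  have "?p + formal_flip ?p = r_formal"
    by (simp add: r_formal_def formal_flip_def lin_ext_sum sum.distrib)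
  then show ?thesis
    unfolding hom_tensor_def by (simp add: tensor_flip_class[OF p] tensor_add_class[OF p formal_flip_in[OF p]])
qed

lemma formal_flip_r: "formal_flip r_formal = r_formal"
  by (simp add: r_formal_def formal_flip_def lin_ext_sum lin_ext_add add.commute)

section \<open>Contraction of the Yang--Baxter expression\<close>

text \<open>Two dual elements multiply to zero, so each surviving term has one slot in
  \<open>A\<close> and two in the dual of \<open>M\<close>. The former is paired with
  \<open>\<alpha>\<close>, the latter give coordinates, and the basis sums collapse by
  \<open>sum_coord\<close>. The formula for \<open>\<phi>\<close> is assumed only on
  \<open>dual_space scaleM\<close>, because a functional on all functions need not have this form
  elsewhere.\<close>

lemma eval_aybe_r:
  assumes \<alpha>: "\<And>i x y. \<alpha> i (x + y) = \<alpha> i x + \<alpha> i y" "\<And>i c x. \<alpha> i (scaleA c x) = c * \<alpha> i x"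
    and \<phi>: "\<And>i a \<xi>. \<xi> \<in> dual_space scaleM \<Longrightarrow> \<phi> i (a, \<xi>) = \<alpha> i a + \<xi> (m i)"
  shows "tensor_eval \<phi> (formal_aybe (semidirect_mult mult l r) r_formal) =
    \<alpha> 0 (defect (m 1) (m 2)) + \<alpha> 1 (defect (m 0) (m 2) - defect (m 2) (m 0))
    - \<alpha> 2 (defect (m 1) (m 0))"
proof -
  have zero: "\<alpha> i 0 = 0" "l 0 x = 0" "r 0 x = 0" "mult 0 a = 0" "mult a 0 = 0" "coord e 0 = 0" for i x a e
    using \<alpha>(1)[of i 0 0] l_add[of 0 0] r_add[of 0 0] A.mult_add_left[of 0 0] A.mult_add_right[of _ 0 0]
      M.representation_zero by simp_all
  have diff: "\<alpha> i (x - y) = \<alpha> i x - \<alpha> i y" for i x y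
    using \<alpha>(1)[of i "x - y" y] by simp
  have dual: "0 \<in> dual_space scaleM" "coord e \<in> dual_space scaleM"
    "dual_action l a (coord e) \<in> dual_space scaleM"
    "dual_action l a (coord e) - dual_action r a (coord e) \<in> dual_space scaleM" for a e
    by (simp_all add: dual_iff coord_simps dual_action_def l_simps r_simps algebra_simps)
  have mults: "semidirect_mult mult l r (a, 0) (b, 0 :: 'm \<Rightarrow> 'k) = (mult a b, 0)"
    "semidirect_mult mult l r (a, 0) (0, coord e) = (0, dual_action l a (coord e))"
    "semidirect_mult mult l r (0, coord e) (a, 0) = (0, dual_action l a (coord e) - dual_action r a (coord e))"
    "semidirect_mult mult l r (0, coord e) (0, coord e') = (0, 0)" for a b e e'
    by (simp_all add: semidirect_mult_def dual_action_def zero fun_eq_iff)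
  have \<phi>': "\<phi> i (a, 0) = \<alpha> i a" "\<phi> i (0, coord e) = coord e (m i)"
    "\<phi> i (0, dual_action l a (coord e)) = coord e (l a (m i))"
    "\<phi> i (0, dual_action l a (coord e) - dual_action r a (coord e)) = coord e (l a (m i)) - coord e (r a (m i))"
    for i a e
    by (simp_all add: \<phi> dual zero) (simp_all add: dual_action_def)
  have pure3: "tensor_eval \<phi> (pure [x, y, z]) = \<phi> 0 x * \<phi> 1 y * \<phi> 2 z" for x y z
    by (simp add: tensor_eval_pure lessThan_Suc numeral_2_eq_2 mult.commute mult.left_commute)
  have S1: "(\<Sum>e\<in>E. \<Sum>e'\<in>E. \<alpha> i (mult (P e) (P e')) * coord e x * coord e' y) = \<alpha> i (mult (P x) (P y))" for i x y
  proof -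
    have "(\<Sum>e'\<in>E. \<alpha> i (mult (P e) (P e')) * coord e x * coord e' y) = \<alpha> i (mult (P e) (P y)) * coord e x" for e
      by (rule sum_coord) (simp_all add: P_simps A.mult_add_right A.mult_scale_right \<alpha> algebra_simps)
    moreover have "(\<Sum>e\<in>E. \<alpha> i (mult (P e) (P y)) * coord e x) = \<alpha> i (mult (P x) (P y))"
      by (rule sum_coord) (simp_all add: P_simps A.mult_add_left A.mult_scale_left \<alpha>)
    ultimately show ?thesis by simp
  qed
  \<comment> \<open>Both actions occur because the right action on the dual is the difference of the
    duals of \<open>l\<close> and \<open>r\<close>. The inner sum reassembles
    \<open>\<psi> (P e) x\<close>; the outer one uses linearity of \<open>\<psi>\<close> in its
    algebra argument.\<close>
  have S2: "(\<Sum>e\<in>E. \<Sum>e'\<in>E. \<alpha> i (P e') * coord e' (\<psi> (P e) x) * coord e y) = \<alpha> i (P (\<psi> (P y) x))"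
    if "\<psi> = l \<or> \<psi> = r" for i x y \<psi>
  proof -
    have "(\<Sum>e'\<in>E. \<alpha> i (P e') * coord e' (\<psi> (P e) x)) = \<alpha> i (P (\<psi> (P e) x))" for e
      by (rule sum_coord) (simp_all add: P_simps \<alpha>)
    moreover have "(\<Sum>e\<in>E. \<alpha> i (P (\<psi> (P e) x)) * coord e y) = \<alpha> i (P (\<psi> (P y) x))"
      by (rule sum_coord) (use that in \<open>auto simp: P_simps \<alpha> l_add r_add l_scale r_scale\<close>)
    ultimately show ?thesis by (simp add: sum_distrib_right[symmetric])
  qed
  \<comment> \<open>\<open>S1'\<close> reorders the factors and \<open>S2'\<close> the summations,
    to match the shapes of the terms listed below.\<close>
  have S1': "(\<Sum>e\<in>E. \<Sum>e'\<in>E. \<alpha> i (mult (P e) (P e')) * coord e' x * coord e y) = \<alpha> i (mult (P y) (P x))" for i x y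
    using S1[of i y x] by (simp add: mult.commute mult.left_commute)
  have S2': "(\<Sum>e\<in>E. \<Sum>e'\<in>E. \<alpha> i (P e) * coord e (\<psi> (P e') x) * coord e' y) = \<alpha> i (P (\<psi> (P y) x))"
    if "\<psi> = l \<or> \<psi> = r" for i x y \<psi>
    by (subst sum.swap) (rule S2[OF that])
  let ?t = "aybe_term (semidirect_mult mult l r)"
  \<comment> \<open>Each of the two copies of \<open>r\<close> contributes a summand of
    \<open>P\<close> or its flip, hence four combinations.\<close>
  have "tensor_eval \<phi> (formal_aybe (semidirect_mult mult l r) r_formal) =
      (\<Sum>e\<in>E. \<Sum>e'\<in>E.
        tensor_eval \<phi> (?t [(P e, 0), (0, coord e)] [(P e', 0), (0, coord e')])
        + tensor_eval \<phi> (?t [(P e, 0), (0, coord e)] [(0, coord e'), (P e', 0)])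
        + tensor_eval \<phi> (?t [(0, coord e), (P e, 0)] [(P e', 0), (0, coord e')])
        + tensor_eval \<phi> (?t [(0, coord e), (P e, 0)] [(0, coord e'), (P e', 0)]))"
    unfolding formal_aybe_def r_formal_def
    by (simp add: lin_ext_sum lin_ext_add tensor_eval_sum tensor_eval_add sum.distrib)
  also have "\<dots> = (\<Sum>e\<in>E. \<Sum>e'\<in>E.
      \<alpha> 0 (mult (P e) (P e')) * coord e (m 1) * coord e' (m 2)
      + \<alpha> 0 (P e) * coord e (l (P e') (m 1)) * coord e' (m 2)
      - \<alpha> 0 (P e) * coord e (r (P e') (m 1)) * coord e' (m 2)
      - \<alpha> 0 (P e') * coord e' (l (P e) (m 1)) * coord e (m 2)
      - \<alpha> 0 (P e') * coord e' (l (P e) (m 2)) * coord e (m 1)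
      + \<alpha> 1 (mult (P e) (P e')) * coord e (m 0) * coord e' (m 2)
      - \<alpha> 1 (mult (P e) (P e')) * coord e' (m 0) * coord e (m 2)
      + \<alpha> 1 (P e) * coord e (l (P e') (m 0)) * coord e' (m 2)
      - \<alpha> 1 (P e) * coord e (r (P e') (m 0)) * coord e' (m 2)
      - \<alpha> 1 (P e) * coord e (l (P e') (m 2)) * coord e' (m 0)
      + \<alpha> 1 (P e) * coord e (r (P e') (m 2)) * coord e' (m 0)
      + \<alpha> 2 (P e') * coord e' (l (P e) (m 0)) * coord e (m 1)
      + \<alpha> 2 (P e') * coord e' (l (P e) (m 1)) * coord e (m 0)
      - \<alpha> 2 (P e) * coord e (l (P e') (m 1)) * coord e' (m 0)
      + \<alpha> 2 (P e) * coord e (r (P e') (m 1)) * coord e' (m 0)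
      - \<alpha> 2 (mult (P e) (P e')) * coord e' (m 0) * coord e (m 1))"
    by (intro sum.cong refl)
      (simp add: aybe_term_def Let_def tensor_eval_add tensor_eval_diff pure3 mults \<phi>' zero algebra_simps)
  \<comment> \<open>The two terms \<open>P (l (P (m 2)) (m 1))\<close> under
    \<open>\<alpha> 0\<close> cancel, as do the two terms \<open>P (l (P (m 0)) (m 1))\<close> under
    \<open>\<alpha> 2\<close>. The rest groups into defects.\<close>
  also have "\<dots> = \<alpha> 0 (defect (m 1) (m 2)) + \<alpha> 1 (defect (m 0) (m 2) - defect (m 2) (m 0))
      - \<alpha> 2 (defect (m 1) (m 0))"
    unfolding sum.distrib sum_subtractf S1 S1' S2[of l, simplified] S2[of r, simplified]
      S2'[of l, simplified] S2'[of r, simplified]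
    by (simp add: defect_def P_simps \<alpha> diff)
  finally show ?thesis .
qed

section \<open>The Yang--Baxter equation and the vanishing of the defect\<close>

lemma formal_aybe_relation_iff:
  "formal_aybe (semidirect_mult mult l r) r_formal
      \<in> tensor_relations (semidirect_scale scaleA) 3 (semidirect_carrier scaleM)
    \<longleftrightarrow> (\<forall>m n. defect m n = 0)"
proof -
  interpret k: vector_space "(*) :: 'k \<Rightarrow> 'k \<Rightarrow> 'k"
    by unfold_locales (auto simp: algebra_simps)
  let ?T = "formal_aybe (semidirect_mult mult l r) r_formal"
  let ?lin = "Vector_Spaces.linear (semidirect_scale scaleA) (*)"
  have iff: "?T \<in> tensor_relations (semidirect_scale scaleA) 3 (semidirect_carrier scaleM) \<longleftrightarrow>
      (\<forall>\<phi>. (\<forall>i. ?lin (\<phi> i)) \<longrightarrow> tensor_eval \<phi> ?T = 0)"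
    by (rule tensor_relations_iff_eval[OF B.vector_space_axioms B.subspace_V B.formal_aybe_in[OF r_formal_in]])
  show ?thesis
  proof
    assume "?T \<in> tensor_relations (semidirect_scale scaleA) 3 (semidirect_carrier scaleM)"
    then have 0: "tensor_eval \<phi> ?T = 0" if "\<And>i. ?lin (\<phi> i)" for \<phi>
      using that iff by blast
    define C where "C = A.extend_basis {}"
    have C: "A.independent C" "A.span C = UNIV"
      using A.independent_extend_basis[of "{}"] A.span_extend_basis[of "{}"] A.independent_empty
      by (simp_all add: C_def)
    have "A.representation C (defect m n) c = 0" for m n c
    proof -
      \<comment> \<open>Only slot \<open>0\<close> sees \<open>A\<close>, through the coordinate at
        \<open>c\<close>. With \<open>m\<close> in slot \<open>1\<close> and \<open>n\<close> in
        slot \<open>2\<close>, the contraction is exactly that coordinate of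
        \<open>defect m n\<close>.\<close>
      let ?\<alpha> = "\<lambda>(i :: nat) a. if i = 0 then A.representation C a c else 0"
      let ?m = "\<lambda>i :: nat. if i = 1 then m else n"
      let ?\<phi> = "\<lambda>i (a, \<xi>). ?\<alpha> i a + \<xi> (?m i)"
      have "?lin (?\<phi> i)" for i
        using C by (intro Vector_Spaces.linear_iff[THEN iffD2] conjI B.vector_space_axioms k.vector_space_axioms)
          (auto simp: A.representation_add A.representation_scale semidirect_scale_def algebra_simps)
      then have "tensor_eval ?\<phi> ?T = 0" by (rule 0)
      moreover have "tensor_eval ?\<phi> ?T = ?\<alpha> 0 (defect (?m 1) (?m 2))
          + ?\<alpha> 1 (defect (?m 0) (?m 2) - defect (?m 2) (?m 0)) - ?\<alpha> 2 (defect (?m 1) (?m 0))"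
        using C by (intro eval_aybe_r) (auto simp: A.representation_add A.representation_scale)
      ultimately show ?thesis by simp
    qed
    then have "defect m n = 0" for m n
      using C A.sum_nonzero_representation_eq[of C "defect m n"] by simp
    then show "\<forall>m n. defect m n = 0" by blast
  next
    assume 0: "\<forall>m n. defect m n = 0"
    have "tensor_eval \<phi> ?T = 0" if "\<And>i. ?lin (\<phi> i)" for \<phi>
    proof -
      have lin: "\<phi> i (x + y) = \<phi> i x + \<phi> i y" "\<phi> i (semidirect_scale scaleA c x) = c * \<phi> i x" for i x y c
        using that[of i] unfolding Vector_Spaces.linear_iff by blast+
      define \<alpha> where "\<alpha> i a = \<phi> i (a, 0)" for i a
      \<comment> \<open>By finite-dimensional duality, \<open>\<phi> i\<close> restricted to the
        dual of \<open>M\<close> is evaluation at a vector, whose coordinates are the values of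
        \<open>\<phi> i\<close> on the dual basis.\<close>
      define m where "m i = (\<Sum>e\<in>E. scaleM (\<phi> i (0, coord e)) e)" for i
      have \<alpha>: "\<alpha> i (x + y) = \<alpha> i x + \<alpha> i y" "\<alpha> i (scaleA c x) = c * \<alpha> i x" for i x y c
      proof -
        have "semidirect_scale scaleA c (x, 0 :: 'm \<Rightarrow> 'k) = (scaleA c x, 0)"
          by (simp add: semidirect_scale_def zero_fun_def)
        then show "\<alpha> i (x + y) = \<alpha> i x + \<alpha> i y" "\<alpha> i (scaleA c x) = c * \<alpha> i x"
          using lin(1)[of i "(x, 0)" "(y, 0)"] lin(2)[of i c "(x, 0)"] by (simp_all add: \<alpha>_def)
      qed
      have "\<phi> i (a, \<xi>) = \<alpha> i a + \<xi> (m i)" if \<xi>: "\<xi> \<in> dual_space scaleM" for i a \<xi>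
      proof -
        have \<xi>_sum: "\<xi> (\<Sum>e\<in>F. scaleM (c e) e) = (\<Sum>e\<in>F. c e * \<xi> e)" for F c
        proof -
          have "\<xi> 0 = 0" using \<xi> by (metis dual_iff add_cancel_right_left add.right_neutral)
          then show ?thesis
            using \<xi> by (induction F rule: infinite_finite_induct) (simp_all add: dual_iff)
        qed
        have "\<phi> i 0 = 0" using lin(1)[of i 0 0] by simp
        then have sum: "\<phi> i (\<Sum>e\<in>F. semidirect_scale scaleA (\<xi> e) (0, coord e)) =
            (\<Sum>e\<in>F. \<phi> i (0, coord e) * \<xi> e)" for F
          by (induction F rule: infinite_finite_induct) (simp_all add: lin mult.commute)
        \<comment> \<open>For \<open>F = E\<close> the second component is \<open>\<xi>\<close>
          itself, so \<open>\<phi> i (0, \<xi>)\<close> is determined by the values on the dual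
          basis.\<close>
        have "(\<Sum>e\<in>F. semidirect_scale scaleA (\<xi> e) (0, coord e)) = (0, \<lambda>x. \<Sum>e\<in>F. \<xi> e * coord e x)" for F
          by (induction F rule: infinite_finite_induct)
            (simp_all add: semidirect_scale_def zero_prod_def zero_fun_def plus_fun_def)
        moreover have "(\<lambda>x. \<Sum>e\<in>E. \<xi> e * coord e x) = \<xi>"
          using \<xi> by (intro ext sum_coord) (simp_all add: dual_iff)
        ultimately have "\<phi> i (0, \<xi>) = \<xi> (m i)"
          using sum[of E] by (simp add: m_def \<xi>_sum)
        then show ?thesis using lin(1)[of i "(a, 0)" "(0, \<xi>)"] by (simp add: \<alpha>_def)
      qed
      from eval_aybe_r[of \<alpha> \<phi> m, OF \<alpha> this] have "tensor_eval \<phi> ?T = \<alpha> 0 0 + \<alpha> 1 0 - \<alpha> 2 0"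
        by (simp add: 0)
      then show ?thesis using \<alpha>(1)[of _ 0 0] by simp
    qed
    then show "?T \<in> tensor_relations (semidirect_scale scaleA) 3 (semidirect_carrier scaleM)"
      using iff by blast
  qed
qed

text \<open>Symmetry is automatic, since the flip fixes \<open>r_formal\<close>, and linearity of
  \<open>P\<close> is a locale assumption. What remains on the two sides is the Yang--Baxter
  equation and the vanishing of \<open>defect\<close>.\<close>

lemma symmetric_aybe_solution_iff:
  "symmetric_aybe_solution (semidirect_scale scaleA) (semidirect_carrier scaleM) (semidirect_mult mult l r)
      (tensor_class (semidirect_scale scaleA) 2 (semidirect_carrier scaleM) r_formal)
    \<longleftrightarrow> relative_Rota_Baxter scaleA mult scaleM l r P"
proof -
  have "tensor_class (semidirect_scale scaleA) 2 (semidirect_carrier scaleM) r_formal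
      \<in> tensor_power (semidirect_scale scaleA) 2 (semidirect_carrier scaleM)"
    unfolding tensor_class_def tensor_power_def using r_formal_in by (rule quotientI)
  moreover have "formal_aybe (semidirect_mult mult l r) r_formal
      \<in> tensor_relations (semidirect_scale scaleA) 3 (semidirect_carrier scaleM)
    \<longleftrightarrow> tensor_aybe (semidirect_scale scaleA) (semidirect_carrier scaleM) (semidirect_mult mult l r)
        (tensor_class (semidirect_scale scaleA) 2 (semidirect_carrier scaleM) r_formal)
      = tensor_zero (semidirect_scale scaleA) 3 (semidirect_carrier scaleM)"
    by (simp add: B.tensor_aybe_class[OF r_formal_in] tensor_zero_def
        tensor_class_eq_iff[OF B.formal_aybe_in[OF r_formal_in] fs.subspace_0[OF subspace_formal_tensors]])
  moreover have "relative_Rota_Baxter scaleA mult scaleM l r P \<longleftrightarrow> (\<forall>m n. defect m n = 0)"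
    by (simp add: relative_Rota_Baxter_def defect_def linear_P)
  ultimately show ?thesis
    by (simp add: symmetric_aybe_solution_def tensor_flip_class[OF r_formal_in] formal_flip_r
        formal_aybe_relation_iff)
qed

end

theorem proposition3p20:
  fixes scaleA :: "'k::field_char_0 \<Rightarrow> 'a::ab_group_add \<Rightarrow> 'a"
    and mult :: "'a \<Rightarrow> 'a \<Rightarrow> 'a"
    and scaleM :: "'k \<Rightarrow> 'm::ab_group_add \<Rightarrow> 'm"
    and l r :: "'a \<Rightarrow> 'm \<Rightarrow> 'm"
    and E :: "'m set"
    and P :: "'m \<Rightarrow> 'a"
  assumes "anti_leibniz_algebra scaleA UNIV mult"
    and "anti_leibniz_bimodule scaleA mult scaleM l r"
    and "finite_dimensional_vector_space scaleM E"
    and "Vector_Spaces.linear scaleM scaleA P"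
  shows "symmetric_aybe_solution
      (semidirect_scale scaleA) (semidirect_carrier scaleM) (semidirect_mult mult l r)
      (tensor_add (semidirect_scale scaleA) 2 (semidirect_carrier scaleM)
        (hom_tensor scaleA scaleM E P)
        (tensor_flip (semidirect_scale scaleA) (semidirect_carrier scaleM)
          (hom_tensor scaleA scaleM E P)))
    \<longleftrightarrow> relative_Rota_Baxter scaleA mult scaleM l r P"
proof -
  interpret bimodule_with_linear_map scaleA mult scaleM l r E P
    using assms by (intro bimodule_with_linear_map.intro bimodule_with_linear_map_axioms.intro)
  show ?thesis
    unfolding r_formal_class by (rule symmetric_aybe_solution_iff)
qed

end
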